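(* Let $X$ be a completely metrizable space. If $\mathrm{Comp}(X)$ is a Borel subset of $\mathrm{CPM}(X)$, then $X$ is separable.
   Context: For a topological space $X$, a continuous pseudometric on $X$ is a continuous map $d\colon X\times X\to[0,\infty)$ such that $d(x,x)=0$, $d(x,y)=d(y,x)$ and $d(x,z)\le d(x,y)+d(y,z)$ for all $x,y,z\in X$. $\mathrm{CPM}(X)$ denotes the set of all continuous pseudometrics on $X$, equipped with the topology induced by the supremum metric $\mathcal{D}_X(d,e)=\sup_{(x,y)\in X^2}|d(x,y)-e(x,y)|\in[0,\infty]$ (equivalently, by the metric $\min\{\mathcal{D}_X,1\}$). For a metrizable space $X$, $\mathrm{Met}(X)\subseteq \mathrm{CPM}(X)$ is the set of all metrics on $X$ that induce the topology of $X$, and $\mathrm{Comp}(X)\subseteq\mathrm{Met}(X)$ is the set of those that are complete. *)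

theory Defs
  imports "HOL-Analysis.Analysis"
begin

text \<open>Functions on \<open>X \<times> X\<close> are represented by total functions that vanish
  outside \<open>topspace X\<close>, so that each continuous pseudometric has exactly one representative.
  The value \<open>0\<close> (rather than \<open>undefined\<close>) is needed because \<^locale>\<open>Metric_space\<close>
  demands nonnegativity and symmetry on the whole type.\<close>

definition CPM :: "'a topology \<Rightarrow> ('a \<Rightarrow> 'a \<Rightarrow> real) set" where
  "CPM X = {d.
     continuous_map (prod_topology X X) euclideanreal (\<lambda>(x, y). d x y) \<and>
     (\<forall>x\<in>topspace X. \<forall>y\<in>topspace X. 0 \<le> d x y) \<and>
     (\<forall>x\<in>topspace X. d x x = 0) \<and>
     (\<forall>x\<in>topspace X. \<forall>y\<in>topspace X. d x y = d y x) \<and>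
     (\<forall>x\<in>topspace X. \<forall>y\<in>topspace X. \<forall>z\<in>topspace X. d x z \<le> d x y + d y z) \<and>
     (\<forall>x y. x \<notin> topspace X \<or> y \<notin> topspace X \<longrightarrow> d x y = 0)}"

definition sup_dist ::
    "'a topology \<Rightarrow> ('a \<Rightarrow> 'a \<Rightarrow> real) \<Rightarrow> ('a \<Rightarrow> 'a \<Rightarrow> real) \<Rightarrow> ennreal" where
  "sup_dist X d e = (SUP (x, y)\<in>topspace X \<times> topspace X. ennreal \<bar>d x y - e x y\<bar>)"

text \<open>The library's metric spaces have finite distances, so the topology of the extended metric
  \<open>sup_dist X\<close> is introduced through its truncation at \<open>1\<close>; the lemma
  \<open>openin_CPM_topology\<close> below describes it by \<open>sup_dist X\<close> itself.\<close>

definition CPM_topology :: "'a topology \<Rightarrow> ('a \<Rightarrow> 'a \<Rightarrow> real) topology" where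
  "CPM_topology X = Metric_space.mtopology (CPM X) (\<lambda>d e. enn2real (min (sup_dist X d e) 1))"

definition Met :: "'a topology \<Rightarrow> ('a \<Rightarrow> 'a \<Rightarrow> real) set" where
  "Met X = {d \<in> CPM X. Metric_space (topspace X) d \<and> Metric_space.mtopology (topspace X) d = X}"

definition Comp :: "'a topology \<Rightarrow> ('a \<Rightarrow> 'a \<Rightarrow> real) set" where
  "Comp X = {d \<in> Met X. Metric_space.mcomplete (topspace X) d}"

definition borel_sets_of :: "'a topology \<Rightarrow> 'a set set" where
  "borel_sets_of T = sigma_sets (topspace T) {U. openin T U}"

lemma sup_dist_commute: "sup_dist X d e = sup_dist X e d"
  by (simp add: sup_dist_def abs_minus_commute)

lemma sup_dist_upper:
  "x \<in> topspace X \<Longrightarrow> y \<in> topspace X \<Longrightarrow> ennreal \<bar>d x y - e x y\<bar> \<le> sup_dist X d e"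
  unfolding sup_dist_def by (rule SUP_upper2[of "(x, y)"]) auto

lemma sup_dist_triangle: "sup_dist X d f \<le> sup_dist X d e + sup_dist X e f"
proof -
  have "ennreal \<bar>d x y - f x y\<bar> \<le> sup_dist X d e + sup_dist X e f"
    if "x \<in> topspace X" "y \<in> topspace X" for x y
  proof -
    have "ennreal \<bar>d x y - f x y\<bar> \<le> ennreal (\<bar>d x y - e x y\<bar> + \<bar>e x y - f x y\<bar>)"
      by (rule ennreal_leI) linarith
    also have "\<dots> = ennreal \<bar>d x y - e x y\<bar> + ennreal \<bar>e x y - f x y\<bar>"
      by (simp add: ennreal_plus)
    also have "\<dots> \<le> sup_dist X d e + sup_dist X e f"
      by (intro add_mono sup_dist_upper that)
    finally show ?thesis .
  qed
  then show ?thesis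
    by (subst sup_dist_def) (auto intro!: SUP_least)
qed

lemma sup_dist_eq_0_iff:
  assumes "d \<in> CPM X" "e \<in> CPM X"
  shows "sup_dist X d e = 0 \<longleftrightarrow> d = e"
proof
  assume 0: "sup_dist X d e = 0"
  show "d = e"
  proof (intro ext)
    fix x y
    show "d x y = e x y"
    proof (cases "x \<in> topspace X \<and> y \<in> topspace X")
      case True
      then have "ennreal \<bar>d x y - e x y\<bar> \<le> 0"
        using sup_dist_upper[of x X y d e] 0 by simp
      then show ?thesis by simp
    next
      case False
      then show ?thesis using assms unfolding CPM_def by auto
    qed
  qed
next
  assume "d = e"
  then show "sup_dist X d e = 0"
    by (auto simp: sup_dist_def bot_ennreal intro!: antisym SUP_least)
qed

lemma min_1_triangle:
  fixes a b c :: ennreal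
  assumes "a \<le> b + c"
  shows "enn2real (min a 1) \<le> enn2real (min b 1) + enn2real (min c 1)"
proof -
  have "min a 1 \<le> min b 1 + min c 1"
  proof (cases "b \<le> 1 \<and> c \<le> 1")
    case True
    then show ?thesis using assms by (metis min.absorb1 min.coboundedI1)
  next
    case False
    then have "1 \<le> min b 1 + min c 1"
      by (metis add_increasing add_increasing2 linear min.absorb2 order_refl zero_le)
    then show ?thesis
      by (meson min.cobounded2 order_trans)
  qed
  then have "enn2real (min a 1) \<le> enn2real (min b 1 + min c 1)"
    by (intro enn2real_mono) (auto simp: min_less_iff_disj)
  also have "\<dots> = enn2real (min b 1) + enn2real (min c 1)"
    by (rule enn2real_plus) (auto simp: min_less_iff_disj)
  finally show ?thesis .
qed

lemma Metric_space_CPM: "Metric_space (CPM X) (\<lambda>d e. enn2real (min (sup_dist X d e) 1))"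
proof
  fix d e f
  show "0 \<le> enn2real (min (sup_dist X d e) 1)" by simp
  show "enn2real (min (sup_dist X d e) 1) = enn2real (min (sup_dist X e d) 1)"
    by (simp add: sup_dist_commute)
  show "enn2real (min (sup_dist X d f) 1)
      \<le> enn2real (min (sup_dist X d e) 1) + enn2real (min (sup_dist X e f) 1)"
    by (rule min_1_triangle) (rule sup_dist_triangle)
  assume "d \<in> CPM X" "e \<in> CPM X"
  then show "enn2real (min (sup_dist X d e) 1) = 0 \<longleftrightarrow> d = e"
    using sup_dist_eq_0_iff[of d X e]
    by (auto simp: enn2real_eq_0_iff min_def top_unique split: if_splits)
qed

lemma topspace_CPM_topology: "topspace (CPM_topology X) = CPM X"
  unfolding CPM_topology_def by (rule Metric_space.topspace_mtopology[OF Metric_space_CPM])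

lemma openin_CPM_topology:
  "openin (CPM_topology X) U \<longleftrightarrow>
     U \<subseteq> CPM X \<and> (\<forall>d\<in>U. \<exists>\<epsilon>>0. \<forall>e\<in>CPM X. sup_dist X d e < ennreal \<epsilon> \<longrightarrow> e \<in> U)"
proof -
  interpret Metric_space "CPM X" "\<lambda>d e. enn2real (min (sup_dist X d e) 1)"
    by (rule Metric_space_CPM)
  have less: "enn2real (min a 1) < r \<longleftrightarrow> a < ennreal r" if "0 < r" "r \<le> 1" for a :: ennreal and r
  proof (cases "a < 1")
    case True
    then have "a \<noteq> top" by auto
    then obtain s where "a = ennreal s" "0 \<le> s"
      by (cases a) auto
    with True that show ?thesis
      by (simp add: min_def ennreal_less_iff)
  next
    case False
    then have "1 \<le> a" by simp
    moreover have "ennreal r \<le> 1" using that by simp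
    ultimately have "\<not> a < ennreal r" by (meson leD order_trans)
    with \<open>1 \<le> a\<close> that show ?thesis
      by (simp add: min_absorb2)
  qed
  have "(\<exists>r>0. mball d r \<subseteq> U) \<longleftrightarrow>
      (\<exists>\<epsilon>>0. \<forall>e\<in>CPM X. sup_dist X d e < ennreal \<epsilon> \<longrightarrow> e \<in> U)" (is "?L \<longleftrightarrow> ?R")
    if "d \<in> CPM X" for d
  proof
    assume ?L
    then obtain r where r: "r > 0" "mball d r \<subseteq> U" by blast
    have "e \<in> U" if "e \<in> CPM X" "sup_dist X d e < ennreal (min r 1)" for e
    proof -
      have "enn2real (min (sup_dist X d e) 1) < min r 1"
        using less[of "min r 1" "sup_dist X d e"] that r(1) by simp
      then show ?thesis
        using r(2) that(1) \<open>d \<in> CPM X\<close> by (auto simp: mball_def)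
    qed
    moreover have "min r 1 > 0" using r(1) by simp
    ultimately show ?R by blast
  next
    assume ?R
    then obtain r where r: "r > 0" "\<forall>e\<in>CPM X. sup_dist X d e < ennreal r \<longrightarrow> e \<in> U" by blast
    have "mball d (min r 1) \<subseteq> U"
    proof
      fix e assume e: "e \<in> mball d (min r 1)"
      then have "sup_dist X d e < ennreal (min r 1)"
        using less[of "min r 1" "sup_dist X d e"] r(1) by (simp add: mball_def)
      also have "\<dots> \<le> ennreal r" by (rule ennreal_leI) simp
      finally show "e \<in> U" using r(2) e by (simp add: mball_def)
    qed
    moreover have "min r 1 > 0" using r(1) by simp
    ultimately show ?L by blast
  qed
  then show ?thesis
    unfolding CPM_topology_def openin_mtopology by blast
qed

end

theory Submission
  imports Defs
begin

text \<open>If a complete metric \<open>d\<close> of \<open>X\<close> is not totally bounded, there are points \<open>p\<^sub>s\<close>, indexed by the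
  finite sequences \<open>s\<close> of naturals, with pairwise distances at least some \<open>\<epsilon> > 0\<close>. Every set \<open>S\<close> of
  finite sequences defines an ultrametric on the index set that is at most \<open>1\<close>, is topologically
  discrete, and is complete iff \<open>S\<close> has no infinite branch. Scaling it by \<open>\<epsilon>\<close> and using it to shorten
  \<open>d\<close> along the \<open>p\<^sub>s\<close> yields \<open>\<Phi> S \<in> Met X\<close>, which is complete iff \<open>S\<close> has no branch. If \<open>S\<close> and \<open>S'\<close>
  agree on sequences of length less than \<open>n\<close>, then \<open>\<Phi> S\<close> and \<open>\<Phi> S'\<close> differ by at most \<open>\<epsilon> / 2 ^ n\<close>, so
  \<open>\<Phi>\<close> is continuous. Hence if \<open>Comp X\<close> were Borel, so would be the set of all \<open>S\<close> without a branch.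
  But every Borel set of such \<open>S\<close> is the preimage of the sets with a branch under a nonexpansive map,
  and for the set of branchless \<open>S\<close> such a map, made contractive, would have a fixed point with and
  without a branch. So a Borel \<open>Comp X\<close> forces total boundedness, and thereby separability.\<close>

section \<open>Borel sets and infinite branches\<close>

text \<open>Closeness in an ultrametric on sets of finite sequences. The topology is a product of
  discrete spaces, one per length, and is finer than pointwise convergence.\<close>

definition agree :: "nat \<Rightarrow> nat list set \<Rightarrow> nat list set \<Rightarrow> bool" where
  "agree n S S' \<longleftrightarrow> (\<forall>s. length s < n \<longrightarrow> (s \<in> S \<longleftrightarrow> s \<in> S'))"

text \<open>\<open>S\<close> need not be closed under prefixes; a branch asks for every initial
  segment, the empty one included.\<close>

definition has_branch :: "nat list set \<Rightarrow> bool" where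
  "has_branch S \<longleftrightarrow> (\<exists>f. \<forall>n. map f [0..<n] \<in> S)"

definition nonexpansive :: "(nat list set \<Rightarrow> nat list set) \<Rightarrow> bool" where
  "nonexpansive F \<longleftrightarrow> (\<forall>n S S'. agree n S S' \<longrightarrow> agree n (F S) (F S'))"

text \<open>An analogue of being analytic, in the form of a Lipschitz reduction to the sets with a
  branch.\<close>

definition reducible :: "nat list set set \<Rightarrow> bool" where
  "reducible A \<longleftrightarrow> (\<exists>F. nonexpansive F \<and> (\<forall>S. S \<in> A \<longleftrightarrow> has_branch (F S)))"

lemma agree_refl [simp]: "agree n S S"
  by (simp add: agree_def)

lemma agree_sym: "agree n S S' \<Longrightarrow> agree n S' S"
  by (simp add: agree_def)

lemma agree_trans: "agree n S S' \<Longrightarrow> agree n S' S'' \<Longrightarrow> agree n S S''"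
  by (simp add: agree_def)

lemma agree_mono: "agree n S S' \<Longrightarrow> m \<le> n \<Longrightarrow> agree m S S'"
  by (auto simp: agree_def)

lemma nonexpansiveD: "nonexpansive F \<Longrightarrow> agree n S S' \<Longrightarrow> agree n (F S) (F S')"
  by (auto simp: nonexpansive_def)

lemma reducible_open:
  assumes "\<And>S. S \<in> A \<Longrightarrow> \<exists>n. \<forall>S'. agree n S S' \<longrightarrow> S' \<in> A"
  shows "reducible A"
proof -
  define F where "F S = {s. length s \<le> Suc (hd s) \<or> s = [] \<or> (\<forall>S'. agree (hd s) S S' \<longrightarrow> S' \<in> A)}"
    for S
  have "agree n (F S) (F S')" if "agree n S S'" for n S S'
    unfolding agree_def
  proof (intro allI impI)
    fix s :: "nat list" assume s: "length s < n"
    show "s \<in> F S \<longleftrightarrow> s \<in> F S'"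
    proof (cases "length s \<le> Suc (hd s)")
      case False
      then have "agree (hd s) S S'" using s that agree_mono[of n S S' "hd s"] by auto
      then have "agree (hd s) S R \<longleftrightarrow> agree (hd s) S' R" for R
        using agree_trans agree_sym by blast
      then show ?thesis by (simp add: F_def)
    qed (simp add: F_def)
  qed
  moreover have "S \<in> A \<longleftrightarrow> has_branch (F S)" for S
  proof
    assume "S \<in> A"
    then obtain n where n: "\<forall>S'. agree n S S' \<longrightarrow> S' \<in> A" using assms by blast
    have "map (\<lambda>_. n) [0..<k] \<in> F S" for k
      using n by (cases k) (auto simp: F_def hd_map simp del: upt_Suc)
    then show "has_branch (F S)" unfolding has_branch_def by blast
  next
    assume "has_branch (F S)"
    then obtain f where f: "\<And>n. map f [0..<n] \<in> F S" unfolding has_branch_def by blast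
    have "hd (map f [0..<Suc (Suc (f 0))]) = f 0" by (simp add: hd_map del: upt_Suc)
    with f[of "Suc (Suc (f 0))"] show "S \<in> A"
      by (auto simp: F_def simp del: upt_Suc)
  qed
  ultimately show ?thesis unfolding reducible_def nonexpansive_def by blast
qed

text \<open>Membership in \<open>F S\<close> depends only on the length, so a branch says that every
  neighbourhood of \<open>S\<close> meets \<open>A\<close>.\<close>

lemma reducible_closed:
  assumes "\<And>S. S \<notin> A \<Longrightarrow> \<exists>n. \<forall>S'. agree n S S' \<longrightarrow> S' \<notin> A"
  shows "reducible A"
proof -
  define F where "F S = {s :: nat list. \<exists>S'. agree (length s) S S' \<and> S' \<in> A}" for S
  have "agree n (F S) (F S')" if "agree n S S'" for n S S'
    unfolding agree_def
  proof (intro allI impI)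
    fix s :: "nat list" assume s: "length s < n"
    then have "agree (length s) S S'" using that agree_mono by (meson less_imp_le)
    then have "agree (length s) S R \<longleftrightarrow> agree (length s) S' R" for R
      using agree_trans agree_sym by blast
    then show "s \<in> F S \<longleftrightarrow> s \<in> F S'" by (simp add: F_def)
  qed
  moreover have "S \<in> A \<longleftrightarrow> has_branch (F S)" for S
  proof
    assume "S \<in> A"
    then show "has_branch (F S)" unfolding has_branch_def F_def using agree_refl by blast
  next
    assume "has_branch (F S)"
    then obtain f where f: "\<And>n. map f [0..<n] \<in> F S" unfolding has_branch_def by blast
    have "\<exists>S'. agree n S S' \<and> S' \<in> A" for n
      using f[of n] by (simp add: F_def)
    then show "S \<in> A" using assms by blast
  qed
  ultimately show ?thesis unfolding reducible_def nonexpansive_def by blast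
qed

lemma has_branch_shift:
  assumes "\<And>i t. i # t \<in> S \<longleftrightarrow> t \<in> T i" "[] \<in> S"
  shows "has_branch S \<longleftrightarrow> (\<exists>i. has_branch (T i))"
proof
  assume "has_branch S"
  then obtain f where f: "\<And>n. map f [0..<n] \<in> S" unfolding has_branch_def by blast
  have "map (\<lambda>k. f (Suc k)) [0..<n] \<in> T (f 0)" for n
    using f[of "Suc n"] assms(1) by (simp add: upt_conv_Cons map_Suc_upt[symmetric] comp_def del: upt_Suc)
  then show "\<exists>i. has_branch (T i)" unfolding has_branch_def by blast
next
  assume "\<exists>i. has_branch (T i)"
  then obtain i f where f: "\<And>n. map f [0..<n] \<in> T i" unfolding has_branch_def by blast
  have "map (case_nat i f) [0..<n] \<in> S" for n
  proof (cases n)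
    case (Suc m)
    then show ?thesis using f[of m] assms(1)
      by (simp add: upt_conv_Cons map_Suc_upt[symmetric] comp_def del: upt_Suc)
  qed (simp add: assms(2))
  then show "has_branch S" unfolding has_branch_def by blast
qed

text \<open>The first entry of a branch names the index. Placing \<open>F i S\<close> one level
  deeper keeps the combined map nonexpansive.\<close>

lemma reducible_UN:
  assumes "\<And>i :: nat. reducible (A i)"
  shows "reducible (\<Union>i. A i)"
proof -
  obtain F where F: "\<And>i. nonexpansive (F i)" "\<And>i S. S \<in> A i \<longleftrightarrow> has_branch (F i S)"
    using assms unfolding reducible_def by metis
  define G where "G S = {s. case s of [] \<Rightarrow> True | i # t \<Rightarrow> t \<in> F i S}" for S
  have "agree n (G S) (G S')" if "agree n S S'" for n S S'
  proof -
    have "agree n (F i S) (F i S')" for i using F(1) that nonexpansiveD by blast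
    then show ?thesis by (auto simp: agree_def G_def split: list.splits)
  qed
  moreover have "S \<in> (\<Union>i. A i) \<longleftrightarrow> has_branch (G S)" for S
    using has_branch_shift[of "G S" "\<lambda>i. F i S"] F(2) by (simp add: G_def)
  ultimately show ?thesis unfolding reducible_def nonexpansive_def by blast
qed

text \<open>A branch of the tree built here interleaves one branch for each index.\<close>

lemma reducible_INT:
  assumes "\<And>i :: nat. reducible (A i)"
  shows "reducible (\<Inter>i. A i)"
proof -
  obtain F where F: "\<And>i. nonexpansive (F i)" "\<And>i S. S \<in> A i \<longleftrightarrow> has_branch (F i S)"
    using assms unfolding reducible_def by metis
  \<comment> \<open>Position \<open>prod_encode (i, k)\<close> holds entry \<open>k\<close> of the
    \<open>i\<close>-th branch. A prefix of that branch is tested once all its positions lie inside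
    \<open>s\<close>.\<close>
  define G where "G S = {s. \<forall>i m. (\<forall>k<m. prod_encode (i, k) < length s) \<longrightarrow>
      map (\<lambda>k. s ! prod_encode (i, k)) [0..<m] \<in> F i S}" for S
  have "agree n (G S) (G S')" if "agree n S S'" for n S S'
    unfolding agree_def
  proof (intro allI impI)
    fix s :: "nat list" assume s: "length s < n"
    have "t \<in> F i S \<longleftrightarrow> t \<in> F i S'"
      if "\<forall>k<length t. prod_encode (i, k) < length s" for i t
    proof -
      \<comment> \<open>Since \<open>prod_encode (i, k)\<close> is at least \<open>k\<close>, the
        extracted prefix is no longer than \<open>s\<close>, and nonexpansiveness of
        \<open>F i\<close> suffices.\<close>
      have "length t \<le> length s"
      proof (cases "length t")
        case (Suc m)
        then show ?thesis using that le_prod_encode_2[of m i] by (metis Suc_leI le_less_trans lessI)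
      qed simp
      moreover have "agree n (F i S) (F i S')"
        using F(1) \<open>agree n S S'\<close> nonexpansiveD by blast
      ultimately show ?thesis using s by (auto simp: agree_def)
    qed
    then show "s \<in> G S \<longleftrightarrow> s \<in> G S'" by (simp add: G_def)
  qed
  moreover have "S \<in> (\<Inter>i. A i) \<longleftrightarrow> has_branch (G S)" for S
  proof
    assume "S \<in> (\<Inter>i. A i)"
    then have "\<forall>i. \<exists>f. \<forall>n. map f [0..<n] \<in> F i S" using F(2) by (auto simp: has_branch_def)
    then obtain g where g: "\<And>i n. map (g i) [0..<n] \<in> F i S" by metis
    define f where "f j = (case prod_decode j of (i, k) \<Rightarrow> g i k)" for j
    have "map f [0..<n] \<in> G S" for n
    proof -
      have "map (\<lambda>k. map f [0..<n] ! prod_encode (i, k)) [0..<m] = map (g i) [0..<m]"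
        if "\<forall>k<m. prod_encode (i, k) < n" for i m
        using that by (simp add: f_def)
      with g show ?thesis by (simp add: G_def del: map_eq_conv cong del: map_cong)
    qed
    then show "has_branch (G S)" unfolding has_branch_def by blast
  next
    assume "has_branch (G S)"
    then obtain f where f: "\<And>n. map f [0..<n] \<in> G S" unfolding has_branch_def by blast
    have "map (\<lambda>k. f (prod_encode (i, k))) [0..<m] \<in> F i S" for i m
    proof -
      \<comment> \<open>The sum merely bounds the finitely many positions in use.\<close>
      define N where "N = Suc (\<Sum>k<m. prod_encode (i, k))"
      have N: "prod_encode (i, k) < N" if "k < m" for k
        unfolding N_def less_Suc_eq_le using that by (intro member_le_sum) auto
      then have "map (\<lambda>k. map f [0..<N] ! prod_encode (i, k)) [0..<m] \<in> F i S"
        using f[of N] by (simp add: G_def)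
      moreover have "map (\<lambda>k. map f [0..<N] ! prod_encode (i, k)) [0..<m]
          = map (\<lambda>k. f (prod_encode (i, k))) [0..<m]"
        using N by simp
      ultimately show ?thesis by simp
    qed
    then show "S \<in> (\<Inter>i. A i)" using F(2) by (force simp: has_branch_def)
  qed
  ultimately show ?thesis unfolding reducible_def nonexpansive_def by blast
qed

text \<open>The induction carries a set together with its complement because reducibility does not
  pass to complements. Complementation swaps the two claims; a union needs a union for one and an
  intersection for the other.\<close>

lemma reducible_vimage_borel:
  assumes "B \<in> borel_sets_of T"
    and range: "\<And>S. \<Phi> S \<in> topspace T"
    and cont: "\<And>U S. openin T U \<Longrightarrow> \<Phi> S \<in> U \<Longrightarrow> \<exists>n. \<forall>S'. agree n S S' \<longrightarrow> \<Phi> S' \<in> U"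
  shows "reducible (\<Phi> -` B) \<and> reducible (- (\<Phi> -` B))"
  using assms(1) unfolding borel_sets_of_def
proof induction
  case (Basic U)
  then show ?case
    using cont by (intro conjI reducible_open reducible_closed) auto
next
  case Empty
  then show ?case by (auto intro: reducible_open reducible_closed)
next
  case (Compl B)
  moreover have "\<Phi> -` (topspace T - B) = - (\<Phi> -` B)" using range by auto
  ultimately show ?case by simp
next
  case (Union B)
  have "\<Phi> -` (\<Union>i. B i) = (\<Union>i. \<Phi> -` B i)" "- (\<Phi> -` (\<Union>i. B i)) = (\<Inter>i. - (\<Phi> -` B i))" by auto
  with Union show ?case by (metis reducible_UN reducible_INT)
qed

text \<open>Delaying a reduction by one level makes it a contraction; at its fixed point the reduction
  would contradict itself.\<close>

lemma not_reducible_no_branch: "\<not> reducible {S. \<not> has_branch S}"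
proof
  assume "reducible {S. \<not> has_branch S}"
  then obtain F where F: "nonexpansive F" "\<And>S. \<not> has_branch S \<longleftrightarrow> has_branch (F S)"
    unfolding reducible_def by blast
  define G where "G S = {s. case s of [] \<Rightarrow> True | i # t \<Rightarrow> t \<in> F S}" for S
  have G: "agree (Suc n) (G S) (G S')" if "agree n S S'" for n S S'
    using nonexpansiveD[OF F(1) that] by (auto simp: agree_def G_def split: list.splits)
  \<comment> \<open>Approximations to the fixed point: each application of \<open>G\<close> settles
    one more level.\<close>
  define Z where "Z n = (G ^^ n) {}" for n
  have Z: "agree n (Z n) (Z (n + k))" for n k
  proof (induction n)
    case (Suc n)
    then show ?case using G by (simp add: Z_def)
  qed (simp add: agree_def)
  \<comment> \<open>A sequence of length \<open>n\<close> is settled from stage \<open>n + 1\<close>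
    on, since \<open>agree\<close> compares only lengths strictly below its bound.\<close>
  define S where "S = {s. s \<in> Z (Suc (length s))}"
  have S: "agree n S (Z n)" for n
    unfolding agree_def
  proof (intro allI impI)
    fix s :: "nat list" assume "length s < n"
    then show "s \<in> S \<longleftrightarrow> s \<in> Z n"
      using Z[of "Suc (length s)" "n - Suc (length s)"] by (simp add: agree_def S_def)
  qed
  have "agree (Suc n) (G S) S" for n
    using agree_trans[OF G[OF S[of n]] agree_sym] S[of "Suc n"] by (simp add: Z_def)
  then have "G S = S" unfolding agree_def by blast
  moreover have "has_branch (G S) \<longleftrightarrow> has_branch (F S)"
    using has_branch_shift[of "G S" "\<lambda>_. F S"] by (simp add: G_def)
  ultimately show False using F(2) by metis
qed

section \<open>Shortening a metric along a separated set\<close>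

text \<open>The largest pseudometric below \<open>d\<close> giving \<open>p s\<close> and
  \<open>p t\<close> distance at most \<open>w s t\<close>, under the assumptions of the locale
  below. A single jump is enough there, and the value 0 off \<open>M\<close> is the convention of
  \<open>CPM\<close>.\<close>

definition glue ::
    "'a set \<Rightarrow> ('a \<Rightarrow> 'a \<Rightarrow> real) \<Rightarrow> ('i \<Rightarrow> 'a) \<Rightarrow> ('i \<Rightarrow> 'i \<Rightarrow> real) \<Rightarrow> 'a \<Rightarrow> 'a \<Rightarrow> real" where
  "glue M d p w x y = (if x \<in> M \<and> y \<in> M
     then min (d x y) (INF (s, t)\<in>UNIV. d x (p s) + w s t + d (p t) y) else 0)"

text \<open>\<open>w_triangle\<close> and \<open>w_le\<close> let several jumps collapse into one.
  \<open>separated\<close> and \<open>isolated\<close> bound the cost of proper jumps from a given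
  point away from 0, which preserves the topology.\<close>

locale glued_metric = Metric_space M d for M :: "'a set" and d +
  fixes p :: "'i \<Rightarrow> 'a" and w :: "'i \<Rightarrow> 'i \<Rightarrow> real" and \<epsilon> :: real
  assumes p_in [simp]: "p s \<in> M"
    and w_refl [simp]: "w s s = 0"
    and w_nonneg [simp]: "0 \<le> w s t"
    and w_commute: "w s t = w t s"
    and w_triangle: "w s u \<le> w s t + w t u"
    and w_le: "w s t \<le> d (p s) (p t)"
    and eps_pos: "0 < \<epsilon>"
    and separated: "s \<noteq> t \<Longrightarrow> \<epsilon> \<le> d (p s) (p t)"
    and isolated: "\<exists>c>0. \<forall>t. t \<noteq> s \<longrightarrow> c \<le> w s t"
begin

section \<open>Metric axioms of the shortened distance\<close>

abbreviation g :: "'a \<Rightarrow> 'a \<Rightarrow> real" where "g \<equiv> glue M d p w"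

text \<open>The infimum need not be attained; a strict upper bound is always witnessed by a single
  path.\<close>

lemma glue_less_iff:
  assumes "x \<in> M" "y \<in> M"
  shows "g x y < r \<longleftrightarrow> d x y < r \<or> (\<exists>s t. d x (p s) + w s t + d (p t) y < r)"
proof -
  have "bdd_below (range (\<lambda>(s, t). d x (p s) + w s t + d (p t) y))"
    by (rule bdd_belowI[of _ 0]) auto
  then show ?thesis
    using assms by (simp add: glue_def min_less_iff_disj cINF_less_iff)
qed

lemma glue_le: "x \<in> M \<Longrightarrow> y \<in> M \<Longrightarrow> g x y \<le> d x y"
  by (simp add: glue_def)

lemma glue_nonneg: "0 \<le> g x y"
proof (cases "x \<in> M \<and> y \<in> M")
  case True
  have "\<not> d x (p s) + w s t + d (p t) y < 0" for s t
    by (simp add: not_less)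
  then show ?thesis using True glue_less_iff[of x y 0] nonneg[of x y] by (meson not_less)
qed (auto simp: glue_def)

lemma glue_commute: "g x y = g y x"
proof (cases "x \<in> M \<and> y \<in> M")
  case True
  have "g x y < r \<longleftrightarrow> g y x < r" for r
    using True by (simp add: glue_less_iff) (metis add.assoc add.commute commute w_commute)
  then show ?thesis by (meson less_irrefl linorder_neqE_linordered_idom)
qed (auto simp: glue_def)

lemma glue_triangle_less:
  assumes xyz: "x \<in> M" "y \<in> M" "z \<in> M" and "g x y < a" "g y z < b"
  shows "g x z < a + b"
proof -
  consider "d x y < a" "d y z < b"
    | s t where "d x (p s) + w s t + d (p t) y < a" "d y z < b"
    | s t where "d x y < a" "d y (p s) + w s t + d (p t) z < b"
    | s t u v where "d x (p s) + w s t + d (p t) y < a" "d y (p u) + w u v + d (p v) z < b"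
    using assms by (auto simp: glue_less_iff)
  then have "d x z < a + b \<or> (\<exists>s t. d x (p s) + w s t + d (p t) z < a + b)"
  proof cases
    case 1
    then show ?thesis using triangle[OF xyz] by linarith
  next
    case (2 s t)
    then have "d x (p s) + w s t + d (p t) z < a + b"
      using triangle[of "p t" y z] xyz by simp
    then show ?thesis by blast
  next
    case (3 s t)
    then have "d x (p s) + w s t + d (p t) z < a + b"
      using triangle[of x y "p s"] xyz by simp
    then show ?thesis by blast
  next
    case (4 s t u v)
    \<comment> \<open>The two jumps merge into one: the walk from \<open>p t\<close> through
      \<open>y\<close> to \<open>p u\<close> costs at least \<open>w t u\<close>.\<close>
    have "w s v \<le> w s t + w t u + w u v"
      using w_triangle[of s v u] w_triangle[of s u t] by linarith
    also have "\<dots> \<le> w s t + (d (p t) y + d y (p u)) + w u v"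
      using w_le[of t u] triangle[of "p t" y "p u"] xyz by simp
    finally have "d x (p s) + w s v + d (p v) z < a + b" using 4 by linarith
    then show ?thesis by blast
  qed
  then show ?thesis using xyz by (simp add: glue_less_iff)
qed

lemma glue_triangle:
  assumes "x \<in> M" "y \<in> M" "z \<in> M"
  shows "g x z \<le> g x y + g y z"
proof (rule field_le_epsilon)
  fix e :: real assume "0 < e"
  then show "g x z \<le> g x y + g y z + e"
    using glue_triangle_less[OF assms, of "g x y + e / 2" "g y z + e / 2"] by simp
qed

text \<open>At most one \<open>p u\<close> lies within \<epsilon>/2 of \<open>x\<close>. Jumps
  starting elsewhere cost at least \<epsilon>/2; those starting at \<open>p u\<close> cost at least
  the distance to it, or the isolation constant of \<open>u\<close> if
  \<open>x = p u\<close>.\<close>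

lemma jump_lower_bound:
  assumes x: "x \<in> M"
  shows "\<exists>\<delta>>0. \<forall>s t. s \<noteq> t \<longrightarrow> \<delta> \<le> d x (p s) + w s t"
proof (cases "\<exists>u. d x (p u) < \<epsilon> / 2")
  case True
  then obtain u where u: "d x (p u) < \<epsilon> / 2" by blast
  have far: "\<epsilon> / 2 \<le> d x (p s) + w s t" if "s \<noteq> u" for s t
    using that u separated[of s u] triangle[of "p s" x "p u"] x commute[of x "p s"] w_nonneg[of s t]
    by (simp del: w_nonneg)
  show ?thesis
  proof (cases "x = p u")
    case True
    obtain c where c: "c > 0" "\<And>t. t \<noteq> u \<Longrightarrow> c \<le> w u t" using isolated by blast
    have "min c (\<epsilon> / 2) \<le> d x (p s) + w s t" if "s \<noteq> t" for s t
    proof (cases "s = u")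
      case True
      then have "c \<le> w s t" using c(2) that by metis
      then show ?thesis using nonneg[of x "p s"] by linarith
    qed (use far[of s t] in linarith)
    then show ?thesis using c(1) eps_pos by (meson half_gt_zero min_less_iff_conj)
  next
    case False
    then have "d x (p u) > 0" using x by simp
    moreover have "min (d x (p u)) (\<epsilon> / 2) \<le> d x (p s) + w s t" for s t
      using far[of s t] w_nonneg[of s t] by (cases "s = u") (simp_all del: w_nonneg add: min_le_iff_disj)
    ultimately show ?thesis using eps_pos by (meson half_gt_zero min_less_iff_conj)
  qed
next
  case False
  then have "\<epsilon> / 2 \<le> d x (p s) + w s t" for s t
    by (simp add: not_less add_increasing2)
  then show ?thesis using eps_pos by (meson half_gt_zero)
qed

text \<open>Below \<delta> no proper jump is affordable, and a jump with \<open>s = t\<close> is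
  only a detour, so \<open>d\<close> is as small as \<open>g\<close>.\<close>

lemma dist_less_if_glue_less:
  assumes "x \<in> M" "y \<in> M" and \<delta>: "\<And>s t. s \<noteq> t \<Longrightarrow> \<delta> \<le> d x (p s) + w s t"
    and g: "g x y < r" "g x y < \<delta>"
  shows "d x y < r"
proof (rule ccontr)
  assume "\<not> d x y < r"
  then obtain s t where st: "d x (p s) + w s t + d (p t) y < min r \<delta>"
    using assms glue_less_iff[of x y "min r \<delta>"] by auto
  then have "s = t" using \<delta>[of s t] nonneg[of "p t" y] by fastforce
  then show False
    using st triangle[of x "p s" y] assms(1,2) \<open>\<not> d x y < r\<close> by simp
qed

lemma glue_eq_0_iff:
  assumes "x \<in> M" "y \<in> M"
  shows "g x y = 0 \<longleftrightarrow> x = y"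
proof
  assume 0: "g x y = 0"
  obtain \<delta> where "\<delta> > 0" "\<And>s t. s \<noteq> t \<Longrightarrow> \<delta> \<le> d x (p s) + w s t"
    using jump_lower_bound[OF assms(1)] by blast
  then have "d x y < r" if "r > 0" for r
    using dist_less_if_glue_less[OF assms, of \<delta> r] 0 that by simp
  then show "x = y" using assms by (metis nonneg less_irrefl less_le zero)
next
  assume "x = y"
  then show "g x y = 0"
    using glue_le[OF assms] glue_nonneg[of x y] assms by simp
qed

section \<open>Topology of the shortened metric\<close>

sublocale glue: Metric_space M g
  by unfold_locales (simp_all add: glue_nonneg glue_commute glue_eq_0_iff glue_triangle)

text \<open>One inclusion is \<open>g \<le> d\<close>. For the other, sufficiently small
  \<open>g\<close>-balls lie in the corresponding \<open>d\<close>-balls, with a threshold depending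
  on the centre.\<close>

lemma mtopology_glue: "glue.mtopology = mtopology"
proof (rule topology_eq[THEN iffD2], intro allI iffI)
  fix U assume U: "openin glue.mtopology U"
  show "openin mtopology U"
    unfolding openin_mtopology
  proof (intro conjI allI impI)
    show "U \<subseteq> M" using U by (simp add: glue.openin_mtopology)
    fix x assume "x \<in> U"
    then obtain r where "r > 0" "glue.mball x r \<subseteq> U"
      using U unfolding glue.openin_mtopology by blast
    moreover have "mball x r \<subseteq> glue.mball x r"
      using glue_le by (fastforce simp: mball_def glue.mball_def)
    ultimately show "\<exists>r>0. mball x r \<subseteq> U" by blast
  qed
next
  fix U assume U: "openin mtopology U"
  show "openin glue.mtopology U"
    unfolding glue.openin_mtopology
  proof (intro conjI allI impI)
    show "U \<subseteq> M" using U by (simp add: openin_mtopology)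
    fix x assume "x \<in> U"
    then obtain r where r: "r > 0" "mball x r \<subseteq> U"
      using U unfolding openin_mtopology by blast
    have "x \<in> M" using \<open>x \<in> U\<close> \<open>U \<subseteq> M\<close> by blast
    then obtain \<delta> where \<delta>: "\<delta> > 0" "\<And>s t. s \<noteq> t \<Longrightarrow> \<delta> \<le> d x (p s) + w s t"
      using jump_lower_bound[of x] by blast
    have "glue.mball x (min r \<delta>) \<subseteq> mball x r"
    proof
      fix y assume "y \<in> glue.mball x (min r \<delta>)"
      then show "y \<in> mball x r"
        using dist_less_if_glue_less[of x y \<delta> r] \<delta>(2) by simp
    qed
    then show "\<exists>r>0. glue.mball x r \<subseteq> U"
      using r \<delta>(1) by (intro exI[of _ "min r \<delta>"]) auto
  qed
qed

lemma continuous_map_glue: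
  "continuous_map (prod_topology mtopology mtopology) euclideanreal (\<lambda>(x, y). g x y)"
  using continuous_map_mdist[of "prod_topology mtopology mtopology" "metric (M, g)" fst snd] mtopology_glue
  by (simp add: case_prod_beta' continuous_map_fst continuous_map_snd)

lemma glue_in_Met: "g \<in> Met mtopology"
proof -
  have "g x y = 0" if "x \<notin> M \<or> y \<notin> M" for x y
    using that by (auto simp: glue_def)
  then show ?thesis
    using continuous_map_glue glue.Metric_space_axioms mtopology_glue glue_triangle glue_commute
    by (simp add: Met_def CPM_def)
qed

text \<open>If infinitely many terms of a \<open>g\<close>-Cauchy sequence stay \<eta> away from all
  \<open>p s\<close>, jumps from them cost at least \<eta>, so they form a \<open>d\<close>-Cauchy
  subsequence. Otherwise the terms approach the \<open>p s\<close>, the nearby indices are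
  \<open>w\<close>-Cauchy and hence eventually constant, and the corresponding \<open>p s\<close> is
  the limit.\<close>

lemma mcomplete_glue:
  assumes "mcomplete"
    and w: "\<And>\<sigma> :: nat \<Rightarrow> 'i. \<forall>e>0. \<exists>N. \<forall>m\<ge>N. \<forall>n\<ge>N. w (\<sigma> m) (\<sigma> n) < e \<Longrightarrow> \<exists>s N. \<forall>n\<ge>N. \<sigma> n = s"
  shows "glue.mcomplete"
  unfolding glue.mcomplete_def
proof (intro allI impI)
  fix x assume x: "glue.MCauchy x"
  then have xM: "x n \<in> M" for n by (auto simp: glue.MCauchy_def)
  show "\<exists>l. limitin glue.mtopology x l sequentially"
  proof (cases "\<exists>\<eta>>0. infinite {n. \<forall>s. \<eta> \<le> d (x n) (p s)}")
    case True
    then obtain \<eta> where \<eta>: "\<eta> > 0" "infinite {n. \<forall>s. \<eta> \<le> d (x n) (p s)}" by blast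
    obtain r :: "nat \<Rightarrow> nat"
      where "strict_mono r" "\<forall>n. r n \<in> {n. \<forall>s. \<eta> \<le> d (x n) (p s)}"
      using infinite_enumerate[OF \<eta>(2)] by blast
    then have r: "strict_mono r" "\<And>n s. \<eta> \<le> d (x (r n)) (p s)" by auto
    have "glue.MCauchy (x \<circ> r)" using r(1) x glue.MCauchy_subsequence by blast
    have "MCauchy (x \<circ> r)"
      unfolding MCauchy_def
    proof (intro conjI allI impI)
      fix e :: real assume "e > 0"
      then have "min e \<eta> > 0" using \<eta>(1) by simp
      then obtain N where N: "\<And>m n. N \<le> m \<Longrightarrow> N \<le> n \<Longrightarrow> g (x (r m)) (x (r n)) < min e \<eta>"
        using \<open>glue.MCauchy (x \<circ> r)\<close> unfolding glue.MCauchy_def comp_apply by meson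
      have "\<eta> \<le> d (x (r m)) (p s) + w s t" for m s t
        using r(2)[of m s] w_nonneg[of s t] by linarith
      then have "d (x (r m)) (x (r n)) < e" if "N \<le> m" "N \<le> n" for m n
        using N[OF that] dist_less_if_glue_less[of "x (r m)" "x (r n)" \<eta> e] xM by simp
      then show "\<exists>N. \<forall>m n. N \<le> m \<longrightarrow> N \<le> n \<longrightarrow> d ((x \<circ> r) m) ((x \<circ> r) n) < e" by auto
    qed (use xM in auto)
    then obtain l where "limitin mtopology (x \<circ> r) l sequentially"
      using assms(1) unfolding mcomplete_def by blast
    then show ?thesis
      using glue.MCauchy_convergent_subsequence[OF x r(1)] mtopology_glue by auto
  next
    case False
    \<comment> \<open>The unique index within \<epsilon>/2; for the finitely many terms without one
      the choice is arbitrary.\<close>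
    define \<sigma> where "\<sigma> n = (SOME s. d (x n) (p s) < \<epsilon> / 2)" for n
    have \<sigma>: "\<sigma> n = s" if "d (x n) (p s) < \<epsilon> / 2" for n s
    proof -
      have "d (x n) (p (\<sigma> n)) < \<epsilon> / 2" unfolding \<sigma>_def using that by (rule someI)
      then have "d (p (\<sigma> n)) (p s) < \<epsilon>"
        using that triangle[of "p (\<sigma> n)" "x n" "p s"] commute[of "x n" "p (\<sigma> n)"] xM[of n] by simp
      then show ?thesis using separated[of "\<sigma> n" s] by force
    qed
    have near: "\<exists>N. \<forall>n\<ge>N. d (x n) (p (\<sigma> n)) < e" if "e > 0" for e
    proof -
      have "finite {n. \<forall>s. min e (\<epsilon> / 2) \<le> d (x n) (p s)}" using False eps_pos that by auto
      then obtain N where N: "\<And>n. \<forall>s. min e (\<epsilon> / 2) \<le> d (x n) (p s) \<Longrightarrow> n < N"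
        using finite_nat_set_iff_bounded by auto
      have "d (x n) (p (\<sigma> n)) < e" if n: "N \<le> n" for n
      proof -
        obtain s where "d (x n) (p s) < min e (\<epsilon> / 2)" using N[of n] n by (meson not_less)
        then show ?thesis using \<sigma>[of n s] by auto
      qed
      then show ?thesis by blast
    qed
    have "\<exists>N. \<forall>m\<ge>N. \<forall>n\<ge>N. w (\<sigma> m) (\<sigma> n) < e" if "e > 0" for e
    proof -
      have "e / 3 > 0" using that by simp
      obtain N1 where N1: "\<And>n. N1 \<le> n \<Longrightarrow> d (x n) (p (\<sigma> n)) < e / 3"
        using near[OF \<open>e / 3 > 0\<close>] by blast
      obtain N2 where N2: "\<And>m n. N2 \<le> m \<Longrightarrow> N2 \<le> n \<Longrightarrow> g (x m) (x n) < e / 3"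
        using x \<open>e / 3 > 0\<close> unfolding glue.MCauchy_def by meson
      have "w (\<sigma> m) (\<sigma> n) < e" if mn: "max N1 N2 \<le> m" "max N1 N2 \<le> n" for m n
      proof -
        \<comment> \<open>No path undercuts \<open>w s t\<close>: its \<open>d\<close>-legs between
          points of the family cost at least the corresponding values of \<open>w\<close>.\<close>
        have w_le_glue: "w s t \<le> g (p s) (p t)" for s t
        proof -
          have "\<not> d (p s) (p s') + w s' t' + d (p t') (p t) < w s t" for s' t'
            using w_triangle[of s t s'] w_triangle[of s' t t'] w_le[of s s'] w_le[of t' t] by linarith
          then show ?thesis using glue_less_iff[of "p s" "p t" "w s t"] w_le[of s t] by auto
        qed
        have "g (p (\<sigma> m)) (p (\<sigma> n)) \<le> g (p (\<sigma> m)) (x m) + g (x m) (x n) + g (x n) (p (\<sigma> n))"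
          using glue_triangle[of "p (\<sigma> m)" "x m" "p (\<sigma> n)"] glue_triangle[of "x m" "x n" "p (\<sigma> n)"] xM
          by simp
        also have "\<dots> < e"
          using N1[of m] N1[of n] N2[of m n] mn glue_le[of "x m" "p (\<sigma> m)"] glue_le[of "x n" "p (\<sigma> n)"]
            glue_commute[of "p (\<sigma> m)" "x m"] xM by simp
        finally show ?thesis using w_le_glue[of "\<sigma> m" "\<sigma> n"] by linarith
      qed
      then show ?thesis by blast
    qed
    then obtain s N where s: "\<And>n. n \<ge> N \<Longrightarrow> \<sigma> n = s" using w[of \<sigma>] by blast
    have "limitin mtopology x (p s) sequentially"
      unfolding limitin_metric eventually_sequentially
    proof (intro conjI allI impI)
      fix e :: real assume "e > 0"
      then obtain N' where "\<And>n. n \<ge> N' \<Longrightarrow> d (x n) (p (\<sigma> n)) < e" using near by blast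
      then have "\<forall>n\<ge>max N N'. x n \<in> M \<and> d (x n) (p s) < e" using s xM by fastforce
      then show "\<exists>N. \<forall>n\<ge>N. x n \<in> M \<and> d (x n) (p s) < e" by blast
    qed simp
    then show ?thesis using mtopology_glue by auto
  qed
qed

text \<open>The points \<open>p (\<sigma> n)\<close> are \<open>g\<close>-Cauchy because
  \<open>g\<close> is at most \<open>w\<close> there. A limit would also be a
  \<open>d\<close>-limit, contradicting their \<epsilon>-separation.\<close>

lemma not_mcomplete_glue:
  fixes \<sigma> :: "nat \<Rightarrow> 'i"
  assumes "inj \<sigma>" and w: "\<And>e. e > 0 \<Longrightarrow> \<exists>N. \<forall>m\<ge>N. \<forall>n\<ge>N. w (\<sigma> m) (\<sigma> n) < e"
  shows "\<not> glue.mcomplete"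
proof
  assume "glue.mcomplete"
  have "g (p s) (p t) \<le> w s t" for s t
  proof (rule field_le_epsilon)
    fix e :: real assume "e > 0"
    then have "d (p s) (p s) + w s t + d (p t) (p t) < w s t + e" by simp
    then show "g (p s) (p t) \<le> w s t + e"
      using glue_less_iff[of "p s" "p t" "w s t + e"] by (meson less_imp_le p_in)
  qed
  then have "glue.MCauchy (\<lambda>n. p (\<sigma> n))"
    unfolding glue.MCauchy_def using w by (meson image_subsetI le_less_trans p_in)
  then obtain l where "limitin mtopology (\<lambda>n. p (\<sigma> n)) l sequentially"
    using \<open>glue.mcomplete\<close> mtopology_glue unfolding glue.mcomplete_def by auto
  then have "MCauchy (\<lambda>n. p (\<sigma> n))" by (intro convergent_imp_MCauchy) auto
  then obtain N where "\<And>m n. N \<le> m \<Longrightarrow> N \<le> n \<Longrightarrow> d (p (\<sigma> m)) (p (\<sigma> n)) < \<epsilon>"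
    using eps_pos unfolding MCauchy_def by meson
  then have "d (p (\<sigma> N)) (p (\<sigma> (Suc N))) < \<epsilon>" by simp
  moreover have "\<sigma> N \<noteq> \<sigma> (Suc N)" using \<open>inj \<sigma>\<close> by (auto dest: injD)
  ultimately show False using separated by force
qed

end

text \<open>Each path has at most one jump, so the error \<delta> enters only once.\<close>

lemma glue_le_glue_add:
  assumes "glued_metric M d p w \<epsilon>" "glued_metric M d p w' \<epsilon>"
    and le: "\<And>s t. w s t \<le> w' s t + \<delta>" and "0 \<le> \<delta>"
  shows "glue M d p w x y \<le> glue M d p w' x y + \<delta>"
proof (cases "x \<in> M \<and> y \<in> M")
  case True
  interpret A: glued_metric M d p w \<epsilon> by fact
  interpret B: glued_metric M d p w' \<epsilon> by fact
  show ?thesis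
  proof (rule field_le_epsilon)
    fix e :: real assume "e > 0"
    then have "B.g x y < B.g x y + e" by simp
    then consider "d x y < B.g x y + e"
      | s t where "d x (p s) + w' s t + d (p t) y < B.g x y + e"
      using B.glue_less_iff True by blast
    then have "A.g x y < B.g x y + \<delta> + e"
    proof cases
      case 1
      then show ?thesis using A.glue_le[of x y] True \<open>0 \<le> \<delta>\<close> by linarith
    next
      case (2 s t)
      then have "d x (p s) + w s t + d (p t) y < B.g x y + \<delta> + e" using le[of s t] by linarith
      then show ?thesis using A.glue_less_iff True by blast
    qed
    then show "A.g x y \<le> B.g x y + \<delta> + e" by simp
  qed
qed (use \<open>0 \<le> \<delta>\<close> in \<open>auto simp: glue_def\<close>)

lemma sup_dist_glue_le:
  assumes "glued_metric M d p w \<epsilon>" "glued_metric M d p w' \<epsilon>"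
    and "\<And>s t. \<bar>w s t - w' s t\<bar> \<le> \<delta>"
  shows "sup_dist X (glue M d p w) (glue M d p w') \<le> ennreal \<delta>"
proof -
  have "0 \<le> \<delta>" using assms(3) by (meson abs_ge_zero order_trans)
  have w: "w s t \<le> w' s t + \<delta>" "w' s t \<le> w s t + \<delta>" for s t
    using assms(3)[of s t] by linarith+
  have "\<bar>glue M d p w x y - glue M d p w' x y\<bar> \<le> \<delta>" for x y
    using glue_le_glue_add[OF assms(1,2) w(1) \<open>0 \<le> \<delta>\<close>, of x y]
      glue_le_glue_add[OF assms(2,1) w(2) \<open>0 \<le> \<delta>\<close>, of x y] by linarith
  then show ?thesis
    unfolding sup_dist_def by (auto intro!: SUP_least ennreal_leI)
qed

section \<open>The ultrametric of a set of finite sequences\<close>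

text \<open>The strict bound \<open>j < k\<close> makes level \<open>k\<close> depend only on the
  sequences in \<open>S\<close> shorter than \<open>k\<close>.\<close>

definition joined :: "nat list set \<Rightarrow> nat \<Rightarrow> nat list \<Rightarrow> nat list \<Rightarrow> bool" where
  "joined S k s t \<longleftrightarrow>
     k \<le> length s \<and> k \<le> length t \<and> take k s = take k t \<and> (\<forall>j<k. take j s \<in> S)"

text \<open>For \<open>S = UNIV\<close> this is the usual longest-common-prefix ultrametric; a
  prefix missing from \<open>S\<close> stops the count early.\<close>

definition tree_dist :: "nat list set \<Rightarrow> nat list \<Rightarrow> nat list \<Rightarrow> real" where
  "tree_dist S s t = (if s = t then 0 else (1/2) ^ (GREATEST k. joined S k s t))"

lemma joined_0 [simp]: "joined S 0 s t"
  by (simp add: joined_def)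

lemma joined_take:
  assumes "joined S k s t" "j \<le> k"
  shows "take j s = take j t"
proof -
  have "take j (take k s) = take j (take k t)" using assms(1) by (simp add: joined_def)
  then show ?thesis using assms(2) by (simp add: min_absorb1)
qed

lemma joined_mono:
  assumes "joined S k s t" "j \<le> k"
  shows "joined S j s t"
  using assms joined_take[OF assms] by (simp add: joined_def)

lemma joined_sym:
  assumes "joined S k s t"
  shows "joined S k t s"
proof -
  have "take j t \<in> S" if "j < k" for j
    using joined_take[OF assms, of j, symmetric] assms that by (simp add: joined_def)
  then show ?thesis using assms by (simp add: joined_def)
qed

lemma joined_trans: "joined S k s t \<Longrightarrow> joined S k t u \<Longrightarrow> joined S k s u"
  by (auto simp: joined_def)

lemma joined_agree: "agree n S S' \<Longrightarrow> k \<le> n \<Longrightarrow> joined S k s t \<longleftrightarrow> joined S' k s t"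
  by (auto simp: joined_def agree_def)

lemma tree_dist_same [simp]: "tree_dist S s s = 0"
  by (simp add: tree_dist_def)

lemma tree_dist_nonneg [simp]: "0 \<le> tree_dist S s t"
  by (simp add: tree_dist_def)

text \<open>The joined levels contain 0, are closed downwards and are bounded by
  \<open>length s\<close>, so the greatest one exists and determines them all.\<close>

lemma tree_dist_exponent:
  assumes "s \<noteq> t"
  shows "\<exists>K. tree_dist S s t = (1/2) ^ K \<and> (\<forall>k. joined S k s t \<longleftrightarrow> k \<le> K)"
proof (intro exI conjI allI)
  let ?K = "GREATEST k. joined S k s t"
  have bound: "\<And>k. joined S k s t \<Longrightarrow> k \<le> length s" by (simp add: joined_def)
  show "tree_dist S s t = (1/2) ^ ?K" using assms by (simp add: tree_dist_def)
  fix k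
  show "joined S k s t \<longleftrightarrow> k \<le> ?K"
  proof
    assume "joined S k s t"
    then show "k \<le> ?K" using bound by (rule Greatest_le_nat)
  next
    have "joined S ?K s t" using joined_0 bound by (rule GreatestI_nat)
    then show "k \<le> ?K \<Longrightarrow> joined S k s t" by (rule joined_mono)
  qed
qed

lemma tree_dist_le_iff: "tree_dist S s t \<le> (1/2) ^ k \<longleftrightarrow> s = t \<or> joined S k s t"
proof (cases "s = t")
  case False
  then obtain K where "tree_dist S s t = (1/2) ^ K" "\<forall>k. joined S k s t \<longleftrightarrow> k \<le> K"
    using tree_dist_exponent by blast
  then show ?thesis using False by simp
qed simp

lemma tree_dist_le_1: "tree_dist S s t \<le> 1"
  using tree_dist_le_iff[of S s t 0] by simp

lemma tree_dist_commute: "tree_dist S s t = tree_dist S t s"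
proof -
  have "joined S k s t \<longleftrightarrow> joined S k t s" for k using joined_sym by blast
  then show ?thesis by (auto simp: tree_dist_def)
qed

lemma tree_dist_ultra: "tree_dist S s u \<le> max (tree_dist S s t) (tree_dist S t u)"
proof (cases "s = t \<or> t = u")
  case False
  define a b where "a = (GREATEST k. joined S k s t)" and "b = (GREATEST k. joined S k t u)"
  have a: "tree_dist S s t = (1/2) ^ a" and b: "tree_dist S t u = (1/2) ^ b"
    using False by (simp_all add: tree_dist_def a_def b_def)
  have "joined S a s t" "joined S b t u"
    using a b False tree_dist_le_iff[of S s t a] tree_dist_le_iff[of S t u b] by auto
  then have "joined S (min a b) s u"
    by (meson joined_mono joined_trans min.cobounded1 min.cobounded2)
  then show ?thesis
    using tree_dist_le_iff[of S s u "min a b"] a b by (auto simp: min_def max_def split: if_splits)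
qed auto

lemma tree_dist_triangle: "tree_dist S s u \<le> tree_dist S s t + tree_dist S t u"
  using tree_dist_ultra[of S s u t] tree_dist_nonneg[of S s t] tree_dist_nonneg[of S t u] by linarith

lemma tree_dist_isolated: "t \<noteq> s \<Longrightarrow> (1/2) ^ Suc (length s) \<le> tree_dist S s t"
  using tree_dist_le_iff[of S s t "Suc (length s)"] by (simp add: joined_def)

text \<open>Both sets give the same joined levels up to \<open>n\<close>: either both exponents
  reach \<open>n\<close>, or they coincide.\<close>

lemma tree_dist_agree:
  assumes "agree n S S'"
  shows "\<bar>tree_dist S s t - tree_dist S' s t\<bar> \<le> (1/2) ^ n"
proof (cases "s = t")
  case False
  obtain K where K: "tree_dist S s t = (1/2) ^ K" "\<forall>k. joined S k s t \<longleftrightarrow> k \<le> K"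
    using tree_dist_exponent[OF False, of S] by blast
  obtain K' where K': "tree_dist S' s t = (1/2) ^ K'" "\<forall>k. joined S' k s t \<longleftrightarrow> k \<le> K'"
    using tree_dist_exponent[OF False, of S'] by blast
  have le: "k \<le> K \<longleftrightarrow> k \<le> K'" if "k \<le> n" for k
    using joined_agree[OF assms that] K(2) K'(2) by blast
  show ?thesis
  proof (cases "n \<le> K")
    case True
    then have "tree_dist S s t \<le> (1/2) ^ n" "tree_dist S' s t \<le> (1/2) ^ n"
      using le[of n] K(1) K'(1) by auto
    then show ?thesis using tree_dist_nonneg[of S s t] tree_dist_nonneg[of S' s t] by linarith
  next
    case False
    then have "K = K'" using le[of K] le[of K'] le[of n] by auto
    then show ?thesis using K(1) K'(1) by simp
  qed
qed simp

text \<open>Otherwise the terms share ever longer prefixes lying in \<open>S\<close>, and these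
  prefixes converge to a branch.\<close>

lemma tree_dist_Cauchy_imp_eventually_const:
  fixes \<sigma> :: "nat \<Rightarrow> nat list"
  assumes "\<not> has_branch S"
    and cau: "\<And>e. e > 0 \<Longrightarrow> \<exists>N. \<forall>m\<ge>N. \<forall>n\<ge>N. tree_dist S (\<sigma> m) (\<sigma> n) < e"
  shows "\<exists>s N. \<forall>n\<ge>N. \<sigma> n = s"
proof (rule ccontr)
  assume nonconst: "\<nexists>s N. \<forall>n\<ge>N. \<sigma> n = s"
  have "\<exists>N. \<forall>m\<ge>N. \<forall>n\<ge>N. \<sigma> m = \<sigma> n \<or> joined S k (\<sigma> m) (\<sigma> n)" for k
  proof -
    obtain N where "\<forall>m\<ge>N. \<forall>n\<ge>N. tree_dist S (\<sigma> m) (\<sigma> n) < (1/2) ^ k"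
      using cau[of "(1/2) ^ k"] by auto
    then show ?thesis by (meson less_imp_le tree_dist_le_iff)
  qed
  then obtain N where N: "\<And>k m n. N k \<le> m \<Longrightarrow> N k \<le> n \<Longrightarrow> \<sigma> m = \<sigma> n \<or> joined S k (\<sigma> m) (\<sigma> n)"
    by metis
  \<comment> \<open>Non-constancy supplies a later term different from \<open>\<sigma> n\<close>,
    which excludes the equality alternative.\<close>
  have long: "k \<le> length (\<sigma> n)" "\<forall>j<k. take j (\<sigma> n) \<in> S" if "N k \<le> n" for k n
  proof -
    obtain m where "N k \<le> m" "\<sigma> m \<noteq> \<sigma> n" using nonconst by blast
    then have "joined S k (\<sigma> n) (\<sigma> m)" using N[of k n m] that by auto
    then show "k \<le> length (\<sigma> n)" "\<forall>j<k. take j (\<sigma> n) \<in> S" by (auto simp: joined_def)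
  qed
  \<comment> \<open>Entry \<open>j\<close> no longer changes from index \<open>N (Suc j)\<close>
    on.\<close>
  define f where "f j = \<sigma> (N (Suc j)) ! j" for j
  have "map f [0..<k] \<in> S" for k
  proof -
    \<comment> \<open>A common bound for \<open>N 0\<close> to \<open>N (Suc k)\<close>; level
      \<open>Suc k\<close> is needed because joining at that level puts the prefix of length
      \<open>k\<close> in \<open>S\<close>.\<close>
    define n where "n = (\<Sum>j\<le>Suc k. N j)"
    have n: "N j \<le> n" if "j \<le> Suc k" for j
      unfolding n_def using that by (intro member_le_sum) auto
    have "map f [0..<k] = take k (\<sigma> n)"
    proof (rule nth_equalityI)
      show "length (map f [0..<k]) = length (take k (\<sigma> n))"
        using long(1)[OF n[of k]] by simp
      fix j assume "j < length (map f [0..<k])"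
      then have j: "j < k" by simp
      have "\<sigma> (N (Suc j)) = \<sigma> n \<or> joined S (Suc j) (\<sigma> (N (Suc j))) (\<sigma> n)"
        using N[of "Suc j" "N (Suc j)" n] n[of "Suc j"] j by simp
      then have "take (Suc j) (\<sigma> (N (Suc j))) = take (Suc j) (\<sigma> n)" by (auto simp: joined_def)
      then have "\<sigma> (N (Suc j)) ! j = \<sigma> n ! j" by (metis lessI nth_take)
      then show "map f [0..<k] ! j = take k (\<sigma> n) ! j" using j by (simp add: f_def)
    qed
    then show ?thesis using long(2)[OF n[of "Suc k"]] by simp
  qed
  then show False using assms(1) unfolding has_branch_def by blast
qed

text \<open>Initial segments of length at least \<open>N\<close> are joined at level
  \<open>N\<close>, so a branch provides an injective Cauchy sequence.\<close>

lemma tree_dist_branch_Cauchy: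
  assumes f: "\<And>n. map f [0..<n] \<in> S" and "e > 0"
  shows "\<exists>N. \<forall>m\<ge>N. \<forall>n\<ge>N. tree_dist S (map f [0..<m]) (map f [0..<n]) < e"
proof -
  obtain N where N: "(1/2) ^ N < e" using real_arch_pow_inv[OF \<open>e > 0\<close>, of "1/2"] by auto
  have "joined S N (map f [0..<m]) (map f [0..<n])" if "N \<le> m" "N \<le> n" for m n
    using that f by (simp add: joined_def take_map)
  then have "tree_dist S (map f [0..<m]) (map f [0..<n]) < e" if "N \<le> m" "N \<le> n" for m n
    using that N tree_dist_le_iff by (meson le_less_trans)
  then show ?thesis by blast
qed

section \<open>Borel completeness forces total boundedness\<close>

context Metric_space
begin

text \<open>The union of finite nets of radius 1/(n+1) is countable and dense.\<close>

lemma mtotally_bounded_imp_separable_space: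
  assumes "mtotally_bounded M"
  shows "separable_space mtopology"
proof -
  have "\<exists>K. finite K \<and> K \<subseteq> M \<and> M \<subseteq> (\<Union>x\<in>K. mball x (1 / Suc n))" for n :: nat
    using assms unfolding mtotally_bounded_def by simp
  then obtain K where K: "\<And>n :: nat. finite (K n) \<and> K n \<subseteq> M \<and> M \<subseteq> (\<Union>x\<in>K n. mball x (1 / Suc n))"
    by metis
  have "\<exists>y\<in>\<Union>n. K n. y \<in> mball x r" if "x \<in> M" "r > 0" for x r
  proof -
    obtain n where n: "1 / Suc n < r" using \<open>r > 0\<close> nat_approx_posE by blast
    obtain y where "y \<in> K n" "x \<in> mball y (1 / Suc n)" using K[of n] \<open>x \<in> M\<close> by blast
    then show ?thesis using n commute[of x y] by (intro bexI[of _ y]) auto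
  qed
  then have "mtopology closure_of (\<Union>n. K n) = M" by (auto simp: metric_closure_of)
  moreover have "countable (\<Union>n. K n)" using K by (intro countable_UN) (auto intro: countable_finite)
  ultimately show ?thesis
    unfolding separable_space_def using K by (metis UN_least topspace_mtopology)
qed

text \<open>Each point is chosen outside the \<epsilon>-balls around the finitely many earlier ones,
  which never cover \<open>M\<close>.\<close>

lemma separated_sequence_if_not_mtotally_bounded:
  assumes "\<not> mtotally_bounded M"
  obtains \<epsilon> :: real and q :: "nat \<Rightarrow> 'a"
  where "\<epsilon> > 0" "range q \<subseteq> M" "\<And>m n. m \<noteq> n \<Longrightarrow> \<epsilon> \<le> d (q m) (q n)"
proof -
  have "\<exists>\<epsilon>>0. \<forall>K\<subseteq>M. finite K \<longrightarrow> \<not> M \<subseteq> (\<Union>x\<in>K. mball x \<epsilon>)"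
    using assms by (simp add: mtotally_bounded_def)
  then obtain \<epsilon> where \<epsilon>: "\<epsilon> > 0"
    "\<forall>K\<subseteq>M. finite K \<longrightarrow> \<not> M \<subseteq> (\<Union>x\<in>K. mball x \<epsilon>)"
    by (elim exE conjE)
  have "\<exists>q :: nat \<Rightarrow> 'a. \<forall>n. q n \<in> M \<and> (\<forall>m<n. \<epsilon> \<le> d (q m) (q n))"
  proof (rule dependent_wellorder_choice)
    fix n :: nat and q
    assume q: "\<And>m. m < n \<Longrightarrow> q m \<in> M \<and> (\<forall>k<m. \<epsilon> \<le> d (q k) (q m))"
    then have "\<not> M \<subseteq> (\<Union>x\<in>q ` {..<n}. mball x \<epsilon>)" by (intro \<epsilon>(2)[rule_format]) auto
    then obtain r where "r \<in> M" "r \<notin> (\<Union>x\<in>q ` {..<n}. mball x \<epsilon>)" by (meson subsetI)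
    then have "r \<in> M" "\<forall>m<n. r \<notin> mball (q m) \<epsilon>" by auto
    then show "\<exists>r. r \<in> M \<and> (\<forall>m<n. \<epsilon> \<le> d (q m) r)" using q by (intro exI[of _ r]) auto
  qed simp
  then obtain q :: "nat \<Rightarrow> 'a" where q: "\<And>n. q n \<in> M" "\<And>m n. m < n \<Longrightarrow> \<epsilon> \<le> d (q m) (q n)"
    by blast
  have "\<epsilon> \<le> d (q m) (q n)" if "m \<noteq> n" for m n
    using q(2)[of m n] q(2)[of n m] that commute[of "q m" "q n"] by (cases "m < n") auto
  then show thesis using \<epsilon>(1) q(1) by (intro that[of \<epsilon> q]) auto
qed

lemma Comp_borel_imp_mtotally_bounded:
  assumes "mcomplete" and borel: "Comp mtopology \<in> borel_sets_of (CPM_topology mtopology)"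
  shows "mtotally_bounded M"
proof (rule ccontr)
  assume "\<not> mtotally_bounded M"
  then obtain \<epsilon> q where \<epsilon>: "\<epsilon> > 0" and q: "range q \<subseteq> M"
    and sep: "\<And>m n :: nat. m \<noteq> n \<Longrightarrow> \<epsilon> \<le> d (q m) (q n)"
    using separated_sequence_if_not_mtotally_bounded by metis
  \<comment> \<open>The injection \<open>to_nat\<close> transfers the separated sequence to finite
    sequences as indices.\<close>
  define p :: "nat list \<Rightarrow> 'a" where "p s = q (to_nat s)" for s
  \<comment> \<open>As \<open>tree_dist\<close> is at most 1, the factor \<epsilon> keeps
    \<open>w\<close> below the distances of the separated points.\<close>
  define w where "w S s t = \<epsilon> * tree_dist S s t" for S s t
  define \<Phi> where "\<Phi> S = glue M d p (w S)" for S
  have p: "s \<noteq> t \<Longrightarrow> \<epsilon> \<le> d (p s) (p t)" for s t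
    unfolding p_def by (rule sep) simp
  have glued: "glued_metric M d p (w S) \<epsilon>" for S
  proof
    fix s t u
    show "p s \<in> M" using q by (auto simp: p_def)
    show "w S s s = 0" "0 \<le> w S s t" using \<epsilon> by (simp_all add: w_def)
    show "w S s t = w S t s" by (simp add: w_def tree_dist_commute)
    show "w S s u \<le> w S s t + w S t u"
      using mult_left_mono[OF tree_dist_triangle[of S s u t], of \<epsilon>] \<epsilon> by (simp add: w_def distrib_left)
    show "w S s t \<le> d (p s) (p t)"
    proof (cases "s = t")
      case False
      have "w S s t \<le> \<epsilon>" using tree_dist_le_1[of S s t] \<epsilon> by (simp add: w_def)
      then show ?thesis using p[OF False] by linarith
    qed (simp add: w_def)
    show "s \<noteq> t \<Longrightarrow> \<epsilon> \<le> d (p s) (p t)" by (rule p)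
    have "\<epsilon> * (1/2) ^ Suc (length s) \<le> w S s t" if "t \<noteq> s" for t
      using mult_left_mono[OF tree_dist_isolated[OF that, of S], of \<epsilon>] \<epsilon> by (simp add: w_def)
    moreover have "\<epsilon> * (1/2) ^ Suc (length s) > 0" using \<epsilon> by simp
    ultimately show "\<exists>c>0. \<forall>t. t \<noteq> s \<longrightarrow> c \<le> w S s t" by blast
  qed (fact \<epsilon>)
  have w_less: "w S s t < e \<longleftrightarrow> tree_dist S s t < e / \<epsilon>" for S s t e
    using \<epsilon> by (simp add: w_def field_simps)
  have Comp: "\<Phi> S \<in> Comp mtopology \<longleftrightarrow> \<not> has_branch S" for S
  proof -
    interpret glued_metric M d p "w S" \<epsilon> by (rule glued)
    have "glue.mcomplete \<longleftrightarrow> \<not> has_branch S"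
    proof
      assume "glue.mcomplete"
      show "\<not> has_branch S"
      proof
        assume "has_branch S"
        then obtain f where f: "\<And>n. map f [0..<n] \<in> S" unfolding has_branch_def by blast
        have "inj (\<lambda>n. map f [0..<n])" by (rule injI) (metis diff_zero length_map length_upt)
        moreover have "\<exists>N. \<forall>m\<ge>N. \<forall>n\<ge>N. w S (map f [0..<m]) (map f [0..<n]) < e" if "e > 0" for e
          unfolding w_less using that \<epsilon> by (intro tree_dist_branch_Cauchy f) simp
        ultimately show False using not_mcomplete_glue \<open>glue.mcomplete\<close> by blast
      qed
    next
      assume S: "\<not> has_branch S"
      show "glue.mcomplete"
      proof (rule mcomplete_glue[OF \<open>mcomplete\<close>])
        fix \<sigma> :: "nat \<Rightarrow> nat list"
        assume cau: "\<forall>e>0. \<exists>N. \<forall>m\<ge>N. \<forall>n\<ge>N. w S (\<sigma> m) (\<sigma> n) < e"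
        have "\<exists>N. \<forall>m\<ge>N. \<forall>n\<ge>N. tree_dist S (\<sigma> m) (\<sigma> n) < e" if "e > 0" for e
          using cau[rule_format, of "\<epsilon> * e"] that \<epsilon> by (simp add: w_less)
        then show "\<exists>s N. \<forall>n\<ge>N. \<sigma> n = s"
          by (rule tree_dist_Cauchy_imp_eventually_const[OF S])
      qed
    qed
    then show ?thesis using glue_in_Met by (simp add: Comp_def \<Phi>_def)
  qed
  have "\<Phi> S \<in> topspace (CPM_topology mtopology)" for S
    using glued_metric.glue_in_Met[OF glued] by (simp add: topspace_CPM_topology \<Phi>_def Met_def)
  moreover have "\<exists>n. \<forall>S'. agree n S S' \<longrightarrow> \<Phi> S' \<in> U"
    if U: "openin (CPM_topology mtopology) U" "\<Phi> S \<in> U" for U S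
  proof -
    obtain e where e: "e > 0"
      "\<And>f. f \<in> CPM mtopology \<Longrightarrow> sup_dist mtopology (\<Phi> S) f < ennreal e \<Longrightarrow> f \<in> U"
      using U unfolding openin_CPM_topology by blast
    obtain n where "(1/2) ^ n < e / \<epsilon>"
      using real_arch_pow_inv[of "e / \<epsilon>" "1/2"] e(1) \<epsilon> by auto
    then have n: "\<epsilon> * (1/2) ^ n < e" using \<epsilon> by (simp add: field_simps)
    have "\<Phi> S' \<in> U" if "agree n S S'" for S'
    proof (rule e(2))
      show "\<Phi> S' \<in> CPM mtopology"
        using glued_metric.glue_in_Met[OF glued] by (simp add: \<Phi>_def Met_def)
      have "\<bar>w S s t - w S' s t\<bar> \<le> \<epsilon> * (1/2) ^ n" for s t
        using mult_left_mono[OF tree_dist_agree[OF that, of s t], of \<epsilon>] \<epsilon>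
        by (simp add: w_def abs_mult flip: right_diff_distrib)
      then have "sup_dist mtopology (\<Phi> S) (\<Phi> S') \<le> ennreal (\<epsilon> * (1/2) ^ n)"
        unfolding \<Phi>_def by (rule sup_dist_glue_le[OF glued glued])
      also have "\<dots> < ennreal e" using n \<epsilon> by (simp add: ennreal_less_iff)
      finally show "sup_dist mtopology (\<Phi> S) (\<Phi> S') < ennreal e" .
    qed
    then show ?thesis by blast
  qed
  ultimately have "reducible (\<Phi> -` Comp mtopology)"
    using reducible_vimage_borel[OF borel] by blast
  moreover have "\<Phi> -` Comp mtopology = {S. \<not> has_branch S}" using Comp by auto
  ultimately show False using not_reducible_no_branch by simp
qed

end

theorem corollary3p9:
  fixes X :: "'a topology"
  assumes "completely_metrizable_space X"
    and "Comp X \<in> borel_sets_of (CPM_topology X)"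
  shows "separable_space X"
proof -
  obtain M d where "Metric_space M d" and d: "Metric_space.mcomplete M d" "X = Metric_space.mtopology M d"
    using assms(1) unfolding completely_metrizable_space_def by blast
  interpret Metric_space M d by fact
  show ?thesis
    using assms(2) d Comp_borel_imp_mtotally_bounded mtotally_bounded_imp_separable_space by simp
qed

end
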